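(* Let $F_k$ be the free commutative semigroup on $a_1,\ldots,a_k$, and let $v_1\to w_1,\ldots,v_t\to w_t$ be a finite set of directed relations with $v_i,w_i\in F_k$ and $w_i<_M v_i$ for all $i$. Let $RF:=RFCS(a_1,\ldots,a_k:\ v_1\to w_1,\ldots,v_t\to w_t)$. If this set of relations is locally confluent, then the normal forms bijectively match the elements of $RF$; that is, the map sending each normal form $w\in F_k$ to the element of $RF$ that it represents is a bijection from the set of normal forms onto $RF$.
   Context: $F_k$ is the set of all words $a_1^{i_1}a_2^{i_2}\cdots a_k^{i_k}$ with $(i_1,\ldots,i_k)\in\mathbb{N}^k\setminus\{(0,\ldots,0)\}$ ($\mathbb N$ containing $0$), multiplied by adding exponents; two words are equal iff all exponents agree. $F_k^1$ is $F_k$ with the empty word adjoined as identity. The component-wise order is $a_1^{i_1}\cdots a_k^{i_k}\le_c a_1^{j_1}\cdots a_k^{j_k}$ iff $i_s\le j_s$ for all $s$. The length of $a_1^{i_1}\cdots a_k^{i_k}$ is $i_1+\cdots+i_k$. The military order $<_M$ is the strict total order on $F_k$ with $v<_M w$ iff $v$ has smaller length than $w$, or both have the same length and $v$ is lexicographically smaller than $w$ (where $a_1$ comes before $a_2$, which comes before $a_3$, etc.; thus for $v=a_1^{i_1}\cdots a_k^{i_k}$ and $w=a_1^{j_1}\cdots a_k^{j_k}$ of the same length, $v<_M w$ iff $i_s>j_s$ at the first index $s$ where the exponents differ). All relations in a presentation are directed from military-larger to military-smaller. $RFCS(a_1,\ldots,a_k:\ v_1\to w_1,\ldots,v_t\to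 w_t)$ (the relatively free commutative semigroup) is the quotient semigroup $F_k/\theta_0$, where $\theta_0$ is the smallest congruence of $F_k$ containing all pairs $(v_i,w_i)$; a word $w$ represents the element given by its $\theta_0$-class. A one-step reduction by the relation $v_i\to w_i$ replaces a word $v_iu$ (with $u\in F_k^1$) by $w_iu$. A normal form is a word $w\in F_k$ to which no relation is applicable, i.e. $v_s\not\le_c w$ for all $1\le s\le t$. For words $v_i,v_j$, $\mathrm{lcm}(v_i,v_j)$ is the word whose exponents are the component-wise maxima of those of $v_i$ and $v_j$. The set of relations is locally confluent if for each pair of distinct relations $v_i\to w_i$ and $v_j\to w_j$ the following holds: putting $v:=\mathrm{lcm}(v_i,v_j)$ and letting $w_i'$ and $w_j'$ be the words obtained from $v$ by one-step reduction with the relation $v_i\to w_i$, respectively $v_j\to w_j$ (replacing one occurrence of $v_i$, respectively $v_j$, as a factor of $v$), there is a word $w$ that can be obtained from both $w_i'$ and $w_j'$ by finitely many (possibly zero) one-step reductions using the given relations. *)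

theory Defs
  imports "HOL-Library.Multiset"
begin

text \<open>
  A word \<open>a\<^sub>1\<^bsup>i\<^sub>1\<^esup> \<dots> a\<^sub>k\<^bsup>i\<^sub>k\<^esup>\<close> is the multiset over \<open>{1..k}\<close> in which \<open>s\<close> has multiplicity \<open>i\<^sub>s\<close>.
  Multiplication is \<open>+\<close>, the empty word is \<open>{#}\<close>, length is \<^const>\<open>size\<close>, the component-wise
  order is \<open>\<subseteq>#\<close>, and the lcm (component-wise maximum of exponents) is \<open>\<union>#\<close>.
\<close>

type_synonym word = "nat multiset"

definition words :: "nat \<Rightarrow> word set" where
  "words k = {w. w \<noteq> {#} \<and> set_mset w \<subseteq> {1..k}}"

definition words1 :: "nat \<Rightarrow> word set" where
  "words1 k = insert {#} (words k)"

text \<open>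
  For equal lengths, the larger exponent at the first difference makes the word
  lexicographically (hence military-) smaller, since \<open>a\<^sub>s\<close> precedes all later generators.
\<close>

definition military_less :: "nat \<Rightarrow> word \<Rightarrow> word \<Rightarrow> bool" where
  "military_less k v w \<longleftrightarrow>
     size v < size w \<or>
     size v = size w \<and>
       (\<exists>s\<in>{1..k}. (\<forall>r\<in>{1..<s}. count v r = count w r) \<and> count v s > count w s)"

record 'a semigrp =
  sg_carrier :: "'a set"
  sg_mult :: "'a \<Rightarrow> 'a \<Rightarrow> 'a"

definition sg_congruence :: "'a semigrp \<Rightarrow> 'a rel \<Rightarrow> bool" where
  "sg_congruence S \<theta> \<longleftrightarrow>
     equiv (sg_carrier S) \<theta> \<and>
     (\<forall>(x, y)\<in>\<theta>. \<forall>(x', y')\<in>\<theta>. (sg_mult S x x', sg_mult S y y') \<in> \<theta>)"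

definition generated_congruence :: "'a semigrp \<Rightarrow> 'a rel \<Rightarrow> 'a rel" where
  "generated_congruence S R = \<Inter>{\<theta>. sg_congruence S \<theta> \<and> R \<subseteq> \<theta>}"

definition sg_quotient :: "'a semigrp \<Rightarrow> 'a rel \<Rightarrow> 'a set semigrp" where
  "sg_quotient S \<theta> =
     \<lparr>sg_carrier = sg_carrier S // \<theta>,
      sg_mult = (\<lambda>A B. \<Union>a\<in>A. \<Union>b\<in>B. \<theta> `` {sg_mult S a b})\<rparr>"

definition free_comm_sg :: "nat \<Rightarrow> word semigrp" where
  "free_comm_sg k = \<lparr>sg_carrier = words k, sg_mult = (+)\<rparr>"

text \<open>A relation \<open>v \<rightarrow> w\<close> is the pair \<open>(v, w)\<close>; a presentation is a set of such pairs.\<close>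

definition pres_congruence :: "nat \<Rightarrow> word rel \<Rightarrow> word rel" where
  "pres_congruence k R = generated_congruence (free_comm_sg k) R"

definition RFCS :: "nat \<Rightarrow> word rel \<Rightarrow> word set semigrp" where
  "RFCS k R = sg_quotient (free_comm_sg k) (pres_congruence k R)"

definition represented :: "nat \<Rightarrow> word rel \<Rightarrow> word \<Rightarrow> word set" where
  "represented k R w = pres_congruence k R `` {w}"

definition step_by :: "nat \<Rightarrow> word \<times> word \<Rightarrow> word rel" where
  "step_by k = (\<lambda>(v, w). {(v + u, w + u) | u. u \<in> words1 k})"

definition one_step :: "nat \<Rightarrow> word rel \<Rightarrow> word rel" where
  "one_step k R = (\<Union>\<rho>\<in>R. step_by k \<rho>)"

definition normal_forms :: "nat \<Rightarrow> word rel \<Rightarrow> word set" where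
  "normal_forms k R = {x \<in> words k. \<forall>(v, w)\<in>R. \<not> v \<subseteq># x}"

text \<open>
  The reducts \<open>x\<close> and \<open>y\<close> of the lcm below exist and are unique, by \<open>step_by_lcm\<close>.
\<close>

definition locally_confluent :: "nat \<Rightarrow> word rel \<Rightarrow> bool" where
  "locally_confluent k R \<longleftrightarrow>
     (\<forall>(v, w)\<in>R. \<forall>(v', w')\<in>R. (v, w) \<noteq> (v', w') \<longrightarrow>
        (\<forall>x y. (v \<union># v', x) \<in> step_by k (v, w) \<longrightarrow>
               (v \<union># v', y) \<in> step_by k (v', w') \<longrightarrow>
               (\<exists>z. (x, z) \<in> (one_step k R)\<^sup>* \<and> (y, z) \<in> (one_step k R)\<^sup>*)))"

lemma step_by_lcm:
  assumes "v \<in> words k" "v' \<in> words k"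
  shows "(v \<union># v', x) \<in> step_by k (v, w) \<longleftrightarrow> x = w + (v' - v)"
    and "(v \<union># v', y) \<in> step_by k (v', w') \<longleftrightarrow> y = w' + (v - v')"
proof -
  have *: "(p \<union># q, x) \<in> step_by k (p, w) \<longleftrightarrow> x = w + (q - p)"
    if "q \<in> words k" for p q x w
  proof -
    have "set_mset (q - p) \<subseteq> {1..k}"
      using that by (auto simp: words_def dest: in_diffD)
    then have "q - p \<in> words1 k"
      by (auto simp: words1_def words_def)
    then show ?thesis
      by (auto simp: step_by_def union_mset_def)
  qed
  show "(v \<union># v', x) \<in> step_by k (v, w) \<longleftrightarrow> x = w + (v' - v)"
    using *[OF assms(2)] .
  have c: "v \<union># v' = v' \<union># v" by (rule multiset_eqI) (simp add: max.commute)
  show "(v \<union># v', y) \<in> step_by k (v', w') \<longleftrightarrow> y = w' + (v - v')"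
    unfolding c using *[OF assms(1)] .
qed

lemma sg_congruence_pres:
  assumes "R \<subseteq> words k \<times> words k"
  shows "sg_congruence (free_comm_sg k) (pres_congruence k R)"
    and "R \<subseteq> pres_congruence k R"
proof -
  let ?C = "{\<theta>. sg_congruence (free_comm_sg k) \<theta> \<and> R \<subseteq> \<theta>}"
  have full: "words k \<times> words k \<in> ?C"
    using assms
    by (auto simp: sg_congruence_def free_comm_sg_def equiv_def refl_on_def sym_def trans_def words_def)
  have eq: "equiv (words k) \<theta>" if "\<theta> \<in> ?C" for \<theta>
    using that by (auto simp: sg_congruence_def free_comm_sg_def)
  have "equiv (words k) (\<Inter>?C)"
  proof (rule equivI)
    show "\<Inter>?C \<subseteq> words k \<times> words k" using full by blast
    show "refl_on (words k) (\<Inter>?C)"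
      using eq by (auto simp: equiv_def refl_on_def)
    show "sym (\<Inter>?C)"
      using eq by (intro symI) (auto simp: equiv_def dest: symD)
    show "trans (\<Inter>?C)"
    proof (intro transI InterI)
      fix x y z \<theta> assume "(x, y) \<in> \<Inter>?C" "(y, z) \<in> \<Inter>?C" and \<theta>: "\<theta> \<in> ?C"
      then have "(x, y) \<in> \<theta>" "(y, z) \<in> \<theta>" by blast+
      moreover have "trans \<theta>" using eq[OF \<theta>] by (simp add: equiv_def)
      ultimately show "(x, z) \<in> \<theta>" by (rule transD[rotated])
    qed
  qed
  moreover have "(x + x', y + y') \<in> \<Inter>?C" if "(x, y) \<in> \<Inter>?C" "(x', y') \<in> \<Inter>?C" for x x' y y'
  proof (rule InterI)
    fix \<theta> assume \<theta>: "\<theta> \<in> ?C"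
    then have "(x, y) \<in> \<theta>" "(x', y') \<in> \<theta>" using that by blast+
    then show "(x + x', y + y') \<in> \<theta>"
      using \<theta> by (fastforce simp: sg_congruence_def free_comm_sg_def)
  qed
  ultimately show "sg_congruence (free_comm_sg k) (pres_congruence k R)"
    unfolding pres_congruence_def generated_congruence_def
    by (subst sg_congruence_def) (simp add: free_comm_sg_def split_beta)
  show "R \<subseteq> pres_congruence k R"
    by (auto simp: pres_congruence_def generated_congruence_def)
qed

lemma RFCS_mult_represented:
  assumes "R \<subseteq> words k \<times> words k" "x \<in> words k" "y \<in> words k"
  shows "sg_mult (RFCS k R) (represented k R x) (represented k R y) = represented k R (x + y)"
proof -
  let ?\<theta> = "pres_congruence k R"
  have eq: "equiv (words k) ?\<theta>"
    using sg_congruence_pres(1)[OF assms(1)] by (simp add: sg_congruence_def free_comm_sg_def)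
  have mult: "(x + y, a + b) \<in> ?\<theta>" if "(x, a) \<in> ?\<theta>" "(y, b) \<in> ?\<theta>" for a b
    using sg_congruence_pres(1)[OF assms(1)] that
    by (fastforce simp: sg_congruence_def free_comm_sg_def)
  have cls: "?\<theta> `` {a + b} = ?\<theta> `` {x + y}" if "(x, a) \<in> ?\<theta>" "(y, b) \<in> ?\<theta>" for a b
    using equiv_class_eq[OF eq mult[OF that]] by simp
  have "(x, x) \<in> ?\<theta>" "(y, y) \<in> ?\<theta>"
    using eq assms(2,3) by (auto simp: equiv_def refl_on_def)
  then have "(\<Union>a\<in>?\<theta> `` {x}. \<Union>b\<in>?\<theta> `` {y}. ?\<theta> `` {a + b}) = ?\<theta> `` {x + y}"
    using cls by blast
  then show ?thesis
    by (simp add: RFCS_def sg_quotient_def represented_def free_comm_sg_def)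
qed

end

theory Submission
  imports Defs
begin

text \<open>
  The argument is the standard one for complete rewriting systems, carried out modulo
  commutativity. Reduction terminates: the military order is preserved by multiplication, so every
  step descends in it, and it is well-founded because over \<open>k\<close> generators it embeds into the
  lexicographic order on \<open>(k + 1)\<close>-tuples of natural numbers (\<open>wf_military_less\<close>). Hence every word
  reaches a normal form, and since steps stay inside a congruence class, every class contains one.

  For uniqueness, two relations applicable to the same word \<open>x\<close> have left-hand sides dividing
  \<open>x\<close>, so their lcm divides \<open>x\<close>, and both reductions are translates by one common factor of the two
  reductions of the lcm. The hypothesis on lcms therefore gives joinability of all divergent pairs of
  steps (\<open>one_step_divergence_joins\<close>), and Newman's lemma (\<open>newman\<close>) turns this into confluence.
  Confluence makes joinability a transitive relation, hence a congruence; as it contains the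
  relations, it contains the congruence that they generate (\<open>pres_congruence_joinable\<close>). Two
  congruent normal forms thus reduce to a common word, and having no reducts, they are equal.
\<close>

section \<open>Confluence from termination and local confluence\<close>

text \<open>
  Newman's lemma: local joins at the first two steps propagate, by induction along \<^term>\<open>r\<close>, to a
  join of both branches.
\<close>

lemma newman:
  assumes "wf (r\<inverse>)"
    and local: "\<And>x y z. (x, y) \<in> r \<Longrightarrow> (x, z) \<in> r \<Longrightarrow> \<exists>u. (y, u) \<in> r\<^sup>* \<and> (z, u) \<in> r\<^sup>*"
    and "(x, y) \<in> r\<^sup>*" "(x, z) \<in> r\<^sup>*"
  shows "\<exists>u. (y, u) \<in> r\<^sup>* \<and> (z, u) \<in> r\<^sup>*"
  using assms(1,3,4)
proof (induction x arbitrary: y z rule: wf_induct_rule)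
  case (less x)
  show ?case
  proof (cases "x = y \<or> x = z")
    case True
    then show ?thesis using less.prems by blast
  next
    case False
    then obtain y1 z1 where y1: "(x, y1) \<in> r" "(y1, y) \<in> r\<^sup>*" and z1: "(x, z1) \<in> r" "(z1, z) \<in> r\<^sup>*"
      using less.prems by (meson converse_rtranclE)
    obtain a where a: "(y1, a) \<in> r\<^sup>*" "(z1, a) \<in> r\<^sup>*"
      using local y1(1) z1(1) by blast
    obtain b where b: "(y, b) \<in> r\<^sup>*" "(a, b) \<in> r\<^sup>*"
      using less.IH[of y1 y a] y1 a(1) by blast
    obtain c where "(b, c) \<in> r\<^sup>*" "(z, c) \<in> r\<^sup>*"
      using less.IH[of z1 b z] z1 a(2) b(2) by (meson converse_iff rtrancl_trans)
    then show ?thesis using b(1) by (meson rtrancl_trans)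
  qed
qed

lemma wf_converse_reaches_normal_form:
  assumes "wf (r\<inverse>)"
  shows "\<exists>y. (x, y) \<in> r\<^sup>* \<and> y \<notin> Domain r"
  using assms
proof (induction x rule: wf_induct_rule)
  case (less x)
  show ?case
  proof (cases "x \<in> Domain r")
    case True
    then obtain x' where "(x, x') \<in> r" by blast
    then show ?thesis using less.IH[of x'] by (meson converse_iff converse_rtrancl_into_rtrancl)
  qed blast
qed

section \<open>Words and the military order\<close>

lemma add_words1_closed: "w \<in> words k \<Longrightarrow> u \<in> words1 k \<Longrightarrow> w + u \<in> words k"
  by (auto simp: words_def words1_def)

lemma words1_add_closed: "u \<in> words1 k \<Longrightarrow> u' \<in> words1 k \<Longrightarrow> u + u' \<in> words1 k"
  by (auto simp: words_def words1_def)

lemma diff_words1: "x \<in> words k \<Longrightarrow> x - v \<in> words1 k"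
  by (auto simp: words_def words1_def dest: in_diffD)

lemma military_less_add: "military_less k w v \<Longrightarrow> military_less k (w + u) (v + u)"
  by (auto simp: military_less_def)

text \<open>
  A word is encoded as its length followed by the deficits \<^term>\<open>size v - count v s\<close>. Passing to
  deficits reverses the comparison of exponents, so that a military descent becomes a lexicographic
  descent on lists of natural numbers of one fixed length.
\<close>

lemma wf_military_less: "wf {(v, w). military_less k v w}"
proof -
  define f where "f v = size v # map (\<lambda>s. size v - count v s) [1..<Suc k]" for v :: word
  have len: "length (f v) = Suc k" for v
    by (simp add: f_def)
  have nth: "f v ! i = (if i = 0 then size v else size v - count v i)" if "i \<le> k" for v i
    using that by (cases i) (auto simp: f_def simp del: upt_Suc)
  have "(f v, f w) \<in> lex less_than" if vw: "military_less k v w" for v w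
  proof -
    have "\<exists>i\<le>k. (\<forall>j<i. f v ! j = f w ! j) \<and> f v ! i < f w ! i"
    proof (cases "size v < size w")
      case True
      then show ?thesis by (intro exI[of _ 0]) (simp add: nth)
    next
      case False
      then obtain s where s: "size v = size w" "1 \<le> s" "s \<le> k"
          "\<forall>r\<in>{1..<s}. count v r = count w r" "count v s > count w s"
        using vw by (auto simp: military_less_def)
      have "count v s \<le> size v"
        by (rule count_le_size)
      \<comment> \<open>Truncated subtraction is strictly antitone here because exponents never exceed the length.\<close>
      then show ?thesis
        using s by (intro exI[of _ s]) (auto simp: nth)
    qed
    then obtain i where i: "i \<le> k" "\<forall>j<i. f v ! j = f w ! j" "f v ! i < f w ! i"
      by blast
    then have "take i (f v) = take i (f w)"
      by (intro nth_equalityI) (auto simp: len)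
    then show ?thesis
      using i le_imp_less_Suc[OF i(1)] by (auto simp: lexord_lex lexord_take_index_conv len)
  qed
  then have "{(v, w). military_less k v w} \<subseteq> inv_image (lex less_than) f"
    by auto
  then show ?thesis
    by (rule wf_subset[rotated]) (simp add: wf_lex)
qed

section \<open>One-step reduction\<close>

lemma one_step_iff:
  "(x, y) \<in> one_step k R \<longleftrightarrow> (\<exists>v w u. (v, w) \<in> R \<and> u \<in> words1 k \<and> x = v + u \<and> y = w + u)"
  by (fastforce simp: one_step_def step_by_def)

lemma wf_converse_one_step:
  assumes "\<forall>(v, w)\<in>R. military_less k w v"
  shows "wf ((one_step k R)\<inverse>)"
proof (rule wf_subset[OF wf_military_less])
  show "(one_step k R)\<inverse> \<subseteq> {(v, w). military_less k v w}"
    using assms by (auto simp: one_step_iff intro!: military_less_add)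
qed

lemma one_step_rtrancl_add:
  assumes "(x, y) \<in> (one_step k R)\<^sup>*" "t \<in> words1 k"
  shows "(x + t, y + t) \<in> (one_step k R)\<^sup>*"
  using assms(1)
proof induction
  case (step y z)
  have "(y + t, z + t) \<in> one_step k R"
    using step.hyps(2) assms(2) by (fastforce simp: one_step_iff add.assoc intro: words1_add_closed)
  then show ?case using step.IH by simp
qed simp

lemma normal_forms_iff:
  "x \<in> normal_forms k R \<longleftrightarrow> x \<in> words k \<and> x \<notin> Domain (one_step k R)"
proof -
  have "(\<exists>(v, w)\<in>R. v \<subseteq># x) \<longleftrightarrow> x \<in> Domain (one_step k R)" if "x \<in> words k"
  proof
    assume "\<exists>(v, w)\<in>R. v \<subseteq># x"
    then obtain v w where "(v, w) \<in> R" "x = v + (x - v)"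
      by (auto simp: subset_mset.add_diff_inverse)
    then have "(x, w + (x - v)) \<in> one_step k R"
      unfolding one_step_iff using diff_words1[OF that] by blast
    then show "x \<in> Domain (one_step k R)" by blast
  next
    assume "x \<in> Domain (one_step k R)"
    then obtain v w u where "(v, w) \<in> R" "x = v + u" by (auto simp: one_step_iff)
    then show "\<exists>(v, w)\<in>R. v \<subseteq># x" by (intro bexI[of _ "(v, w)"]) auto
  qed
  then show ?thesis by (auto simp: normal_forms_def)
qed

text \<open>
  Every divergence of two different relations is a translate of the divergence at the lcm of their
  left-hand sides. A single relation cannot diverge, since in a commutative word its reduct does
  not depend on which occurrence of the left-hand side is replaced.
\<close>

lemma one_step_divergence_joins:
  assumes R: "R \<subseteq> words k \<times> words k"
    and lc: "locally_confluent k R"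
    and xy: "(x, y) \<in> one_step k R" and xz: "(x, z) \<in> one_step k R"
  shows "\<exists>t. (y, t) \<in> (one_step k R)\<^sup>* \<and> (z, t) \<in> (one_step k R)\<^sup>*"
proof -
  obtain v w u where vw: "(v, w) \<in> R" "u \<in> words1 k" "x = v + u" "y = w + u"
    using xy by (auto simp: one_step_iff)
  obtain v' w' u' where vw': "(v', w') \<in> R" "u' \<in> words1 k" "x = v' + u'" "z = w' + u'"
    using xz by (auto simp: one_step_iff)
  show ?thesis
  proof (cases "(v, w) = (v', w')")
    case True
    then show ?thesis using vw vw' by auto
  next
    case False
    have words: "v \<in> words k" "v' \<in> words k"
      using R vw(1) vw'(1) by auto
    obtain t where t: "(w + (v' - v), t) \<in> (one_step k R)\<^sup>*" "(w' + (v - v'), t) \<in> (one_step k R)\<^sup>*"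
    proof -
      have "(v \<union># v', w + (v' - v)) \<in> step_by k (v, w)"
        "(v \<union># v', w' + (v - v')) \<in> step_by k (v', w')"
        by (simp_all add: step_by_lcm[OF words])
      then show thesis
        using lc[unfolded locally_confluent_def] vw(1) vw'(1) False that by fast
    qed
    \<comment> \<open>The common factor by which both reductions at the lcm have to be translated.\<close>
    define d where "d = x - (v \<union># v')"
    have "x \<in> words k"
      using vw(2,3) words(1) add_words1_closed by simp
    then have d: "d \<in> words1 k"
      unfolding d_def by (rule diff_words1)
    have count_d: "count d s = count v s + count u s - max (count v s) (count v' s)" for s
      by (simp add: d_def vw(3))
    have exponents: "count v s + count u s = count v' s + count u' s" for s
      using vw(3) vw'(3) by (metis count_union)
    have "count u s = count ((v' - v) + d) s" "count u' s = count ((v - v') + d) s" for s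
      using exponents[of s] count_d[of s] by (auto simp: max_def split: if_splits)
    then have "u = (v' - v) + d" "u' = (v - v') + d"
      by (auto intro: multiset_eqI)
    then show ?thesis
      using one_step_rtrancl_add[OF t(1) d] one_step_rtrancl_add[OF t(2) d] vw(4) vw'(4)
      by (auto simp: add.assoc)
  qed
qed

section \<open>The presented congruence as joinability\<close>

lemma one_step_rtrancl_pres_congruence:
  assumes R: "R \<subseteq> words k \<times> words k"
    and "(x, y) \<in> (one_step k R)\<^sup>*" "x \<in> words k"
  shows "(x, y) \<in> pres_congruence k R"
proof -
  have cong: "equiv (words k) (pres_congruence k R)"
    "\<And>a b c d. (a, b) \<in> pres_congruence k R \<Longrightarrow> (c, d) \<in> pres_congruence k R \<Longrightarrow>
       (a + c, b + d) \<in> pres_congruence k R"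
    using sg_congruence_pres(1)[OF R] by (fastforce simp: sg_congruence_def free_comm_sg_def)+
  have refl: "(a, a) \<in> pres_congruence k R" if "a \<in> words k" for a
    using cong(1) that by (auto simp: equiv_def refl_on_def)
  have one_step: "(a, b) \<in> pres_congruence k R" if "(a, b) \<in> one_step k R" for a b
  proof -
    obtain v w u where vwu: "(v, w) \<in> R" "u \<in> words1 k" "a = v + u" "b = w + u"
      using \<open>(a, b) \<in> one_step k R\<close> by (auto simp: one_step_iff)
    have "(v, w) \<in> pres_congruence k R"
      using sg_congruence_pres(2)[OF R] vwu(1) by blast
    \<comment> \<open>The empty word lies outside the semigroup, so it has no reflexivity pair to multiply by.\<close>
    then show ?thesis
      using vwu cong(2)[OF _ refl, of v w u] by (cases "u = {#}") (auto simp: words1_def)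
  qed
  show ?thesis
    using assms(2)
  proof induction
    case base
    show ?case using refl assms(3) .
  next
    case (step y z)
    then show ?case using one_step cong(1) by (meson equiv_def transD)
  qed
qed

text \<open>
  The generated congruence is an intersection, so it is enough that joinability is one of the
  congruences containing the relations. Confluence is what makes joinability transitive.
\<close>

lemma pres_congruence_joinable:
  assumes R: "R \<subseteq> words k \<times> words k"
    and confl: "\<And>x y z. (x, y) \<in> (one_step k R)\<^sup>* \<Longrightarrow> (x, z) \<in> (one_step k R)\<^sup>* \<Longrightarrow>
      \<exists>t. (y, t) \<in> (one_step k R)\<^sup>* \<and> (z, t) \<in> (one_step k R)\<^sup>*"
    and "(x, y) \<in> pres_congruence k R"
  shows "\<exists>z. (x, z) \<in> (one_step k R)\<^sup>* \<and> (y, z) \<in> (one_step k R)\<^sup>*"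
proof -
  let ?S = "(one_step k R)\<^sup>*"
  define J where "J = {(x, y) \<in> words k \<times> words k. \<exists>z. (x, z) \<in> ?S \<and> (y, z) \<in> ?S}"
  have "equiv (words k) J"
  proof (rule equivI)
    show "J \<subseteq> words k \<times> words k" "refl_on (words k) J" "sym J"
      by (auto simp: J_def refl_on_def sym_def)
    show "trans J"
    proof (rule transI)
      fix a b c assume "(a, b) \<in> J" "(b, c) \<in> J"
      then obtain p q where "a \<in> words k" "c \<in> words k" "(a, p) \<in> ?S" "(b, p) \<in> ?S" "(b, q) \<in> ?S" "(c, q) \<in> ?S"
        by (auto simp: J_def)
      moreover from this obtain t where "(p, t) \<in> ?S" "(q, t) \<in> ?S"
        using confl by blast
      ultimately show "(a, c) \<in> J"
        unfolding J_def by (auto intro: rtrancl_trans)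
    qed
  qed
  moreover have "(a + a', b + b') \<in> J" if ab: "(a, b) \<in> J" "(a', b') \<in> J" for a b a' b'
  proof -
    have words: "a \<in> words k" "b \<in> words k" "a' \<in> words k" "b' \<in> words k"
      using ab by (auto simp: J_def)
    obtain c c' where c: "(a, c) \<in> ?S" "(b, c) \<in> ?S" "(a', c') \<in> ?S" "(b', c') \<in> ?S"
      using ab by (auto simp: J_def)
    \<comment> \<open>Reduce one factor at a time, the other being the translating word.\<close>
    have "(p + p', c + c') \<in> ?S"
      if "(p, c) \<in> ?S" "(p', c') \<in> ?S" "p \<in> words k" "p' \<in> words k" for p p'
    proof -
      have "c \<in> words k"
        using one_step_rtrancl_pres_congruence[OF R that(1,3)] sg_congruence_pres(1)[OF R]
        by (auto simp: sg_congruence_def free_comm_sg_def equiv_def)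
      then have "(p' + c, c' + c) \<in> ?S" "(p + p', c + p') \<in> ?S"
        using that by (auto intro!: one_step_rtrancl_add simp: words1_def)
      then show ?thesis by (simp add: add.commute)
    qed
    then show ?thesis
      using c words add_words1_closed unfolding J_def words1_def by blast
  qed
  ultimately have "sg_congruence (free_comm_sg k) J"
    by (auto simp: sg_congruence_def free_comm_sg_def)
  moreover have "R \<subseteq> J"
  proof
    fix p assume p: "p \<in> R"
    obtain v w where [simp]: "p = (v, w)" by fastforce
    have "(v, w) \<in> one_step k R"
      unfolding one_step_iff using p by (intro exI[of _ v] exI[of _ w] exI[of _ "{#}"]) (simp add: words1_def)
    then show "p \<in> J"
      using R p by (auto simp: J_def)
  qed
  ultimately have "pres_congruence k R \<subseteq> J"
    by (auto simp: pres_congruence_def generated_congruence_def)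
  then show ?thesis using assms(3) by (auto simp: J_def)
qed

section \<open>Normal forms represent the elements bijectively\<close>

theorem theorem8:
  fixes k :: nat and R :: "word rel"
  assumes "finite R"
    and "R \<subseteq> words k \<times> words k"
    and "\<forall>(v, w)\<in>R. military_less k w v"
    and "locally_confluent k R"
  shows "bij_betw (represented k R) (normal_forms k R) (sg_carrier (RFCS k R))"
proof -
  let ?S = "one_step k R" and ?\<theta> = "pres_congruence k R"
  have wf: "wf (?S\<inverse>)"
    using wf_converse_one_step[OF assms(3)] .
  have confl: "\<exists>t. (y, t) \<in> ?S\<^sup>* \<and> (z, t) \<in> ?S\<^sup>*" if "(x, y) \<in> ?S\<^sup>*" "(x, z) \<in> ?S\<^sup>*" for x y z
    using newman[OF wf one_step_divergence_joins[OF assms(2,4)] that] .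
  have eq: "equiv (words k) ?\<theta>"
    using sg_congruence_pres(1)[OF assms(2)] by (simp add: sg_congruence_def free_comm_sg_def)
  have carrier: "sg_carrier (RFCS k R) = words k // ?\<theta>"
    by (simp add: RFCS_def sg_quotient_def free_comm_sg_def)
  show ?thesis
    unfolding bij_betw_def
  proof
    show "inj_on (represented k R) (normal_forms k R)"
    proof (rule inj_onI)
      fix x y
      assume x: "x \<in> normal_forms k R" and y: "y \<in> normal_forms k R"
        and "represented k R x = represented k R y"
      then have "(x, y) \<in> ?\<theta>"
        using eq eq_equiv_class unfolding represented_def normal_forms_iff by metis
      then have "\<exists>z. (x, z) \<in> ?S\<^sup>* \<and> (y, z) \<in> ?S\<^sup>*"
        by (rule pres_congruence_joinable[OF assms(2), rotated]) (rule confl)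
      then obtain z where "(x, z) \<in> ?S\<^sup>*" "(y, z) \<in> ?S\<^sup>*"
        by blast
      then have "x = z" "y = z"
        using x y unfolding normal_forms_iff by (meson Domain.DomainI converse_rtranclE)+
      then show "x = y" by simp
    qed
    show "represented k R ` normal_forms k R = sg_carrier (RFCS k R)"
    proof
      show "represented k R ` normal_forms k R \<subseteq> sg_carrier (RFCS k R)"
        by (auto simp: carrier represented_def normal_forms_iff intro: quotientI)
      show "sg_carrier (RFCS k R) \<subseteq> represented k R ` normal_forms k R"
      proof
        fix A assume "A \<in> sg_carrier (RFCS k R)"
        then obtain x where x: "x \<in> words k" "A = ?\<theta> `` {x}"
          by (auto simp: carrier elim: quotientE)
        obtain y where y: "(x, y) \<in> ?S\<^sup>*" "y \<notin> Domain ?S"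
          using wf_converse_reaches_normal_form[OF wf] by blast
        have xy: "(x, y) \<in> ?\<theta>"
          using one_step_rtrancl_pres_congruence[OF assms(2) y(1) x(1)] .
        then have "y \<in> normal_forms k R"
          using y(2) eq by (auto simp: normal_forms_iff equiv_def)
        moreover have "A = represented k R y"
          using equiv_class_eq[OF eq xy] x(2) by (simp add: represented_def)
        ultimately show "A \<in> represented k R ` normal_forms k R" by blast
      qed
    qed
  qed
qed

end
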